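(* For $a_1,a_2,a_3\in\mathbb{K}$ consider the relation $$R_{a_1,a_2,a_3}:\quad a_1(x_1x_2)x_3+a_2(x_2x_1)x_3+a_3(x_3x_2)x_1+(-2-3a_1+2a_2+2a_3)(x_1x_3)x_2+(-1-2a_1+2a_2+a_3)(x_2x_3)x_1+(-2-2a_1+a_2+2a_3)(x_3x_1)x_2+x_1(x_2x_3)=0.$$ Then for no choice of $a_1,a_2,a_3\in\mathbb{K}$ is the relation $$2(x_1x_2)x_3-2(x_2x_1)x_3+(x_3x_2)x_1-(x_1x_3)x_2+(x_2x_3)x_1-(x_3x_1)x_2-x_1(x_2x_3)+x_2(x_1x_3)-2x_3(x_2x_1)-x_1(x_3x_2)+x_2(x_3x_1)+2x_3(x_1x_2)=0$$ a $\Sigma_3$-linear combination of $R_{a_1,a_2,a_3}$. That is, $R_{a_1,a_2,a_3}$ cannot imply the depolarized form of the transposed Leibniz rule $2x_3\bullet[x_1,x_2]=[x_3\bullet x_1,x_2]+[x_1,x_3\bullet x_2]$, where $x\bullet y=xy+yx$ and $[x,y]=xy-yx$.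
   Context: $\mathbb{K}$ is an algebraically closed field of characteristic $0$. A relation is regarded as a formal $\mathbb{K}$-linear combination $\Phi$ of the twelve monomials $(x_ix_j)x_k$ and $x_i(x_jx_k)$, $\{i,j,k\}=\{1,2,3\}$ (elements of a $12$-dimensional space), set equal to zero. A permutation $\sigma\in\Sigma_3$ acts by $(x_ix_j)x_k\mapsto (x_{\sigma(i)}x_{\sigma(j)})x_{\sigma(k)}$ and $x_i(x_jx_k)\mapsto x_{\sigma(i)}(x_{\sigma(j)}x_{\sigma(k)})$, extended linearly; write $\Phi\circ\sigma$ for the image of $\Phi$. A $\Sigma_3$-linear combination of $\Phi$ is any element $\sum_{\sigma\in\Sigma_3}u_\sigma\,\Phi\circ\sigma$ with $u_\sigma\in\mathbb{K}$; one relation implies another, in the sense used here, when the second is a $\Sigma_3$-linear combination of the first. *)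

theory Defs
  imports
    "HOL-Computational_Algebra.Polynomial"
    "HOL-Combinatorics.Permutations"
    "HOL-Library.Poly_Mapping"
begin

text \<open>
  The library has no free nonassociative algebra. Its basis is the free magma of bracketed words
  in the variables; its elements are the finitely supported formal linear combinations of these.
  The 12-dimensional space of the relations is the span of the words
  \<open>(x\<^sub>i x\<^sub>j) x\<^sub>k\<close> and \<open>x\<^sub>i (x\<^sub>j x\<^sub>k)\<close>
  with \<open>{i, j, k} = {1, 2, 3}\<close>; it is closed under all operations used below.
\<close>

datatype 'v word = Var 'v | Juxt "'v word" "'v word"

type_synonym 'k nonassoc = "nat word \<Rightarrow>\<^sub>0 'k"

definition var :: "nat \<Rightarrow> 'k::field nonassoc" where
  "var i = Poly_Mapping.single (Var i) 1"

definition scale :: "'k::field \<Rightarrow> 'k nonassoc \<Rightarrow> 'k nonassoc" (infixr \<open>\<cdot>\<close> 75) where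
  "c \<cdot> \<Phi> = Poly_Mapping.map (\<lambda>x. c * x) \<Phi>"

definition mult :: "'k::field nonassoc \<Rightarrow> 'k nonassoc \<Rightarrow> 'k nonassoc" (infixl \<open>\<star>\<close> 80) where
  "\<Phi> \<star> \<Psi> = (\<Sum>v\<in>Poly_Mapping.keys \<Phi>. \<Sum>w\<in>Poly_Mapping.keys \<Psi>.
     Poly_Mapping.single (Juxt v w) (Poly_Mapping.lookup \<Phi> v * Poly_Mapping.lookup \<Psi> w))"

definition commutator :: "'k::field nonassoc \<Rightarrow> 'k nonassoc \<Rightarrow> 'k nonassoc" where
  "commutator \<Phi> \<Psi> = \<Phi> \<star> \<Psi> - \<Psi> \<star> \<Phi>"

definition anticommutator :: "'k::field nonassoc \<Rightarrow> 'k nonassoc \<Rightarrow> 'k nonassoc"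
    (infixl \<open>\<bullet>\<close> 80) where
  "\<Phi> \<bullet> \<Psi> = \<Phi> \<star> \<Psi> + \<Psi> \<star> \<Phi>"

text \<open>
  \<open>perm_act \<sigma> \<Phi>\<close> is \<open>\<Phi> \<circ> \<sigma>\<close>: the linear extension of the renaming
  of each \<open>x\<^sub>i\<close> to \<open>x\<^bsub>\<sigma>(i)\<^esub>\<close>.
\<close>

definition perm_act :: "(nat \<Rightarrow> nat) \<Rightarrow> 'k::field nonassoc \<Rightarrow> 'k nonassoc" where
  "perm_act \<sigma> \<Phi> = (\<Sum>w\<in>Poly_Mapping.keys \<Phi>.
     Poly_Mapping.single (map_word \<sigma> w) (Poly_Mapping.lookup \<Phi> w))"

definition is_Sigma3_combination :: "'k::field nonassoc \<Rightarrow> 'k nonassoc \<Rightarrow> bool" where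
  "is_Sigma3_combination \<Psi> \<Phi> \<longleftrightarrow>
     (\<exists>u :: (nat \<Rightarrow> nat) \<Rightarrow> 'k.
        \<Psi> = (\<Sum>\<sigma> | \<sigma> permutes {1, 2, 3}. u \<sigma> \<cdot> perm_act \<sigma> \<Phi>))"

abbreviation x1 :: "'k::field nonassoc" where "x1 \<equiv> var 1"
abbreviation x2 :: "'k::field nonassoc" where "x2 \<equiv> var 2"
abbreviation x3 :: "'k::field nonassoc" where "x3 \<equiv> var 3"

text \<open>A relation \<open>\<Phi> = 0\<close> is represented by its left-hand side \<open>\<Phi>\<close>.\<close>

definition relation_R :: "'k::field \<Rightarrow> 'k \<Rightarrow> 'k \<Rightarrow> 'k nonassoc" where
  "relation_R a1 a2 a3 =
       a1 \<cdot> ((x1 \<star> x2) \<star> x3)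
     + a2 \<cdot> ((x2 \<star> x1) \<star> x3)
     + a3 \<cdot> ((x3 \<star> x2) \<star> x1)
     + (- 2 - 3 * a1 + 2 * a2 + 2 * a3) \<cdot> ((x1 \<star> x3) \<star> x2)
     + (- 1 - 2 * a1 + 2 * a2 + a3) \<cdot> ((x2 \<star> x3) \<star> x1)
     + (- 2 - 2 * a1 + a2 + 2 * a3) \<cdot> ((x3 \<star> x1) \<star> x2)
     + x1 \<star> (x2 \<star> x3)"

definition transposed_Leibniz :: "'k::field nonassoc" where
  "transposed_Leibniz =
       2 \<cdot> ((x1 \<star> x2) \<star> x3) - 2 \<cdot> ((x2 \<star> x1) \<star> x3)
     + (x3 \<star> x2) \<star> x1 - (x1 \<star> x3) \<star> x2
     + (x2 \<star> x3) \<star> x1 - (x3 \<star> x1) \<star> x2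
     - x1 \<star> (x2 \<star> x3) + x2 \<star> (x1 \<star> x3)
     - 2 \<cdot> (x3 \<star> (x2 \<star> x1)) - x1 \<star> (x3 \<star> x2)
     + x2 \<star> (x3 \<star> x1) + 2 \<cdot> (x3 \<star> (x1 \<star> x2))"

end

(*
The word x1(x2x3) is the only one of the form x(yz) in R, so the coefficients of these six words
in the transposed Leibniz rule determine every u_sigma. Comparing the coefficients of three of
the words (xy)z then gives affine equations in a1, a2, a3 that are inconsistent unless 2 = 0.
*)
theory Submission
  imports Defs
begin

lemma lookup_scale: "Poly_Mapping.lookup (c \<cdot> \<Phi>) w = c * Poly_Mapping.lookup \<Phi> w"
  by (simp add: scale_def Poly_Mapping.map.rep_eq when_def)

lemma scale_single: "c \<cdot> Poly_Mapping.single w a = Poly_Mapping.single w (c * a)"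
  by (rule poly_mapping_eqI) (simp add: lookup_scale lookup_single when_def)

lemma mult_single:
  "Poly_Mapping.single v a \<star> Poly_Mapping.single w b = Poly_Mapping.single (Juxt v w) (a * b)"
  \<comment> \<open>A zero coefficient leaves \<open>single\<close> without keys, so the defining
    sum is then empty.\<close>
  by (cases "a = 0 \<or> b = 0") (auto simp: mult_def)

text \<open>Cancellation can shrink the keys of a sum, so expressions indexed by different supports
  cannot be added termwise. Words outside the support contribute zero, hence any finite superset
  serves as a common index set.\<close>

lemma perm_act_superset:
  assumes "finite A" "Poly_Mapping.keys \<Phi> \<subseteq> A"
  shows "perm_act \<sigma> \<Phi> =
    (\<Sum>w\<in>A. Poly_Mapping.single (map_word \<sigma> w) (Poly_Mapping.lookup \<Phi> w))"
  unfolding perm_act_def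
  by (rule sum.mono_neutral_left) (use assms in \<open>auto simp: in_keys_iff\<close>)

lemma perm_act_add: "perm_act \<sigma> (\<Phi> + \<Psi>) = perm_act \<sigma> \<Phi> + perm_act \<sigma> \<Psi>"
proof -
  let ?A = "Poly_Mapping.keys \<Phi> \<union> Poly_Mapping.keys \<Psi>"
  have "Poly_Mapping.keys (\<Phi> + \<Psi>) \<subseteq> ?A"
    by (rule Poly_Mapping.keys_add)
  then show ?thesis
    by (simp add: perm_act_superset[of ?A] lookup_add single_add sum.distrib)
qed

lemma perm_act_single:
  "perm_act \<sigma> (Poly_Mapping.single w a) = Poly_Mapping.single (map_word \<sigma> w) a"
  by (cases "a = 0") (auto simp: perm_act_def)

text \<open>As for \<open>perm_act_add\<close>: over one common set of left words, additivity holds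
  termwise.\<close>

lemma mult_add_left: "(\<Phi> + \<Phi>') \<star> \<Psi> = \<Phi> \<star> \<Psi> + \<Phi>' \<star> \<Psi>"
proof -
  have mult_superset: "\<Xi> \<star> \<Psi> = (\<Sum>v\<in>A. \<Sum>w\<in>Poly_Mapping.keys \<Psi>. Poly_Mapping.single (Juxt v w)
      (Poly_Mapping.lookup \<Xi> v * Poly_Mapping.lookup \<Psi> w))"
    if "finite A" "Poly_Mapping.keys \<Xi> \<subseteq> A" for A \<Xi>
    unfolding mult_def
    by (rule sum.mono_neutral_left) (use that in \<open>auto simp: in_keys_iff\<close>)
  let ?A = "Poly_Mapping.keys \<Phi> \<union> Poly_Mapping.keys \<Phi>'"
  have "Poly_Mapping.keys (\<Phi> + \<Phi>') \<subseteq> ?A"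
    by (rule Poly_Mapping.keys_add)
  then show ?thesis
    by (simp add: mult_superset[of ?A] lookup_add single_add sum.distrib distrib_right)
qed

lemma mult_add_right: "\<Psi> \<star> (\<Phi> + \<Phi>') = \<Psi> \<star> \<Phi> + \<Psi> \<star> \<Phi>'"
proof -
  have mult_superset: "\<Psi> \<star> \<Xi> = (\<Sum>v\<in>Poly_Mapping.keys \<Psi>. \<Sum>w\<in>A. Poly_Mapping.single (Juxt v w)
      (Poly_Mapping.lookup \<Psi> v * Poly_Mapping.lookup \<Xi> w))"
    if "finite A" "Poly_Mapping.keys \<Xi> \<subseteq> A" for A \<Xi>
    unfolding mult_def
    by (intro sum.cong refl sum.mono_neutral_left) (use that in \<open>auto simp: in_keys_iff\<close>)
  let ?A = "Poly_Mapping.keys \<Phi> \<union> Poly_Mapping.keys \<Phi>'"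
  have "Poly_Mapping.keys (\<Phi> + \<Phi>') \<subseteq> ?A"
    by (rule Poly_Mapping.keys_add)
  then show ?thesis
    by (simp add: mult_superset[of ?A] lookup_add single_add sum.distrib distrib_left)
qed

lemma mult_diff_left: "(\<Phi> - \<Phi>') \<star> \<Psi> = \<Phi> \<star> \<Psi> - \<Phi>' \<star> \<Psi>"
  by (metis mult_add_left add_diff_cancel_right' diff_add_cancel)

lemma mult_diff_right: "\<Psi> \<star> (\<Phi> - \<Phi>') = \<Psi> \<star> \<Phi> - \<Psi> \<star> \<Phi>'"
  by (metis mult_add_right add_diff_cancel_right' diff_add_cancel)

text \<open>Ties the twelve-term form to the polarized rule: the three summands expand into four
  words each, all distinct, so nothing cancels.\<close>

lemma transposed_Leibniz_eq:
  "transposed_Leibniz =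
      2 \<cdot> (x3 \<bullet> commutator x1 x2)
      - (commutator (x3 \<bullet> x1) x2 + commutator x1 (x3 \<bullet> x2))"
  by (rule poly_mapping_eqI)
    (simp add: transposed_Leibniz_def commutator_def anticommutator_def
      mult_add_left mult_add_right mult_diff_left mult_diff_right
      lookup_add lookup_minus lookup_scale algebra_simps)

text \<open>The hypothesis excludes the only way out, since the comparison of coefficients ends in
  \<open>2 * 2 = 0\<close>.\<close>

lemma not_is_Sigma3_combination_transposed_Leibniz:
  fixes a1 a2 a3 :: "'k::field"
  assumes char: "(2::'k) \<noteq> 0"
  shows "\<not> is_Sigma3_combination transposed_Leibniz (relation_R a1 a2 a3)"
proof
  assume "is_Sigma3_combination transposed_Leibniz (relation_R a1 a2 a3)"
  then obtain u :: "(nat \<Rightarrow> nat) \<Rightarrow> 'k"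
    where u: "transposed_Leibniz =
      (\<Sum>\<sigma> | \<sigma> permutes {1, 2, 3}. u \<sigma> \<cdot> perm_act \<sigma> (relation_R a1 a2 a3))"
    unfolding is_Sigma3_combination_def by blast
  \<comment> \<open>These three coefficients stay opaque while words are compared; they are unfolded
    only in the last computation.\<close>
  define b where "b = - 2 - 3 * a1 + 2 * a2 + 2 * a3"
  define d where "d = - 1 - 2 * a1 + 2 * a2 + a3"
  define e where "e = - 2 - 2 * a1 + a2 + 2 * a3"
  define l r :: "nat \<Rightarrow> nat \<Rightarrow> nat \<Rightarrow> nat word"
    where "l = (\<lambda>i j k. Juxt (Juxt (Var i) (Var j)) (Var k))"
      and "r = (\<lambda>i j k. Juxt (Var i) (Juxt (Var j) (Var k)))"
  have act: "perm_act \<sigma> (relation_R a1 a2 a3) =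
        Poly_Mapping.single (l (\<sigma> 1) (\<sigma> 2) (\<sigma> 3)) a1
      + Poly_Mapping.single (l (\<sigma> 2) (\<sigma> 1) (\<sigma> 3)) a2
      + Poly_Mapping.single (l (\<sigma> 3) (\<sigma> 2) (\<sigma> 1)) a3
      + Poly_Mapping.single (l (\<sigma> 1) (\<sigma> 3) (\<sigma> 2)) b
      + Poly_Mapping.single (l (\<sigma> 2) (\<sigma> 3) (\<sigma> 1)) d
      + Poly_Mapping.single (l (\<sigma> 3) (\<sigma> 1) (\<sigma> 2)) e
      + Poly_Mapping.single (r (\<sigma> 1) (\<sigma> 2) (\<sigma> 3)) 1" for \<sigma>
    by (simp add: relation_R_def var_def mult_single scale_single perm_act_add perm_act_single
        l_def r_def flip: b_def d_def e_def)
  have coeff: "Poly_Mapping.lookup transposed_Leibniz w =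
      (\<Sum>\<sigma> | \<sigma> permutes {1, 2, 3}. u \<sigma> * Poly_Mapping.lookup (perm_act \<sigma> (relation_R a1 a2 a3)) w)" for w
    by (simp add: u lookup_sum lookup_scale)
  \<comment> \<open>Every permutation of \<open>{1, 2, 3}\<close> is uniquely
    \<open>transpose 1 c\<close> after a permutation of \<open>{2, 3}\<close>, with c among 1, 2, 3;
    this gives the six representatives.\<close>
  have six: "(\<Sum>\<sigma> | \<sigma> permutes {1, 2, 3}. f \<sigma>) =
      f id + f (transpose 2 3) + f (transpose 1 2) + f (transpose 1 2 \<circ> transpose 2 3)
      + f (transpose 1 3) + f (transpose 1 3 \<circ> transpose 2 3)" for f :: "(nat \<Rightarrow> nat) \<Rightarrow> 'k"
    by (simp add: sum_over_permutations_insert algebra_simps)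
  note coeff_six = coeff[unfolded six]
  note expand = transposed_Leibniz_def var_def mult_single scale_single act l_def r_def
    lookup_add lookup_minus lookup_single when_def Transposition.transpose_def
  \<comment> \<open>The image of R under \<sigma> contains exactly one word of the form
    \<open>r i j k\<close>, with coefficient 1, and this word determines \<sigma>. So a single
    summand survives in each of these six comparisons.\<close>
  have "u id = -1" using coeff_six[of "r 1 2 3"] by (simp add: expand del: One_nat_def)
  moreover have "u (transpose 2 3) = -1" using coeff_six[of "r 1 3 2"] by (simp add: expand del: One_nat_def)
  moreover have "u (transpose 1 2) = 1" using coeff_six[of "r 2 1 3"] by (simp add: expand del: One_nat_def)
  moreover have "u (transpose 1 2 \<circ> transpose 2 3) = 1" using coeff_six[of "r 2 3 1"] by (simp add: expand del: One_nat_def)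
  moreover have "u (transpose 1 3) = -2" using coeff_six[of "r 3 2 1"] by (simp add: expand del: One_nat_def)
  moreover have "u (transpose 1 3 \<circ> transpose 2 3) = 2" using coeff_six[of "r 3 1 2"] by (simp add: expand del: One_nat_def)
  ultimately have c: "Poly_Mapping.lookup transposed_Leibniz w =
      - Poly_Mapping.lookup (perm_act id (relation_R a1 a2 a3)) w
      - Poly_Mapping.lookup (perm_act (transpose 2 3) (relation_R a1 a2 a3)) w
      + Poly_Mapping.lookup (perm_act (transpose 1 2) (relation_R a1 a2 a3)) w
      + Poly_Mapping.lookup (perm_act (transpose 1 2 \<circ> transpose 2 3) (relation_R a1 a2 a3)) w
      - 2 * Poly_Mapping.lookup (perm_act (transpose 1 3) (relation_R a1 a2 a3)) w
      + 2 * Poly_Mapping.lookup (perm_act (transpose 1 3 \<circ> transpose 2 3) (relation_R a1 a2 a3)) w"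
    for w
    by (simp add: coeff_six)
  \<comment> \<open>The first minus the other two of the following equations is free of \<open>a1\<close>, \<open>a2\<close>,
    \<open>a3\<close> and reads \<open>2 = - 2\<close>.\<close>
  have "2 = - a1 + a2 - 2 * a3 - b + 2 * d + e"
    using c[of "l 1 2 3"] by (simp add: expand algebra_simps del: One_nat_def)
  moreover have "1 = - 2 * a1 + a2 - a3 + 2 * b - d + e"
    using c[of "l 3 2 1"] by (simp add: expand algebra_simps del: One_nat_def)
  moreover have "- 1 = - a1 + 2 * a2 + a3 - b + d - 2 * e"
    using c[of "l 1 3 2"] by (simp add: expand algebra_simps del: One_nat_def)
  ultimately have "(2::'k) - 1 - (- 1) =
      (- a1 + a2 - 2 * a3 - b + 2 * d + e) - (- 2 * a1 + a2 - a3 + 2 * b - d + e)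
      - (- a1 + 2 * a2 + a3 - b + d - 2 * e)"
    by (simp only:)
  \<comment> \<open>The left side equals \<open>2 * (a1 - a2 - a3 - b + d + e)\<close>. The bracket
    is the sum of the coefficients of the words \<open>l i j k\<close> in R, weighted by the sign of
    the permutation sending 1, 2, 3 to i, j, k; throughout the family it is -1.\<close>
  also have "\<dots> = - 2"
    by (simp add: b_def d_def e_def algebra_simps)
  finally have "(2::'k) * 2 = 0"
    by simp
  with char show False
    by (metis mult_eq_0_iff)
qed

theorem mainTheorem2:
  fixes a1 a2 a3 :: "'k::{alg_closed_field, field_char_0}"
  shows "\<not> is_Sigma3_combination transposed_Leibniz (relation_R a1 a2 a3) \<and>
    (transposed_Leibniz :: 'k nonassoc) =
      2 \<cdot> (x3 \<bullet> commutator x1 x2)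
      - (commutator (x3 \<bullet> x1) x2 + commutator x1 (x3 \<bullet> x2))"
  using not_is_Sigma3_combination_transposed_Leibniz[of a1 a2 a3] transposed_Leibniz_eq
  by simp

end
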